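(* The coefficients of the generating functions $F^{(2)}(x)$ and $F_D^{(2)}(x)$ (case $k=2$) are, for every integer $n\ge 0$, $$[x^n]F^{(2)}(x)=\sum_{m\ge 0}\frac{(-1)^{n-m}}{m+1}\binom{3m+1}{m}\binom{m+1}{n-m},$$ $$[x^n]F_D^{(2)}(x)=\sum_{m\ge 1}\frac{(-1)^{n-m}}{m}\binom{3m}{m-1}\binom{m}{n-m}.$$
   Context: Write $N=(0,1)$, $E=(1,0)$, $D=(1,1)$. A Delannoy path is a lattice path in $\mathbb{Z}^2$ (finite sequence of lattice points) each of whose steps (consecutive differences) belongs to $\{N,E,D\}$. For a positive integer $k$ and a nonnegative integer $n$, $\mathcal{P}^{(k)}_{n,kn}(NE,EN)$ is the set of Delannoy paths from $(0,0)$ to $(n,kn)$ all of whose vertices lie in $\{(x,y)\in\mathbb{Z}^2: y\ge kx\}$ and which contain no two consecutive steps $NE$ (peak) and no two consecutive steps $EN$ (valley). $D\mathcal{P}^{(k)}_{n,kn}(NE,EN)$ is the subset of those paths whose last step is $D$. The generating functions are the formal power series $$F^{(k)}(x)=\sum_{n\ge 0}\#\mathcal{P}^{(k)}_{n,kn}(NE,EN)\,x^n,\qquad F_D^{(k)}(x)=\sum_{n\ge 1}\#D\mathcal{P}^{(k)}_{n,kn}(NE,EN)\,x^n.$$ $[x^n]G(x)$ denotes the coefficient of $x^n$ in $G(x)$. Binomial coefficients $\binom{a}{b}$ (with $a\ge 0$) are $0$ when $b<0$ or $b>a$, so the sums are finite (only terms with $m\le n$ contribute). *)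

theory Defs
  imports
    "HOL-Library.Product_Plus"
    "HOL-Library.Sublist"
    "HOL-Computational_Algebra.Formal_Power_Series"
begin

type_synonym point = "int \<times> int"

definition north :: point where "north = (0, 1)"
definition east :: point where "east = (1, 0)"
definition diag :: point where "diag = (1, 1)"

text \<open>A path is its list of vertices; the one-vertex list is the path with no steps.\<close>

definition path_steps :: "point list \<Rightarrow> point list" where
  "path_steps p = map (\<lambda>i. p ! Suc i - p ! i) [0..<length p - 1]"

definition delannoy_path :: "point list \<Rightarrow> bool" where
  "delannoy_path p \<longleftrightarrow> p \<noteq> [] \<and> set (path_steps p) \<subseteq> {north, east, diag}"

text \<open>
  Here \<open>sublist\<close> means contiguous sublist, so the last two conditions say that no north step
  is immediately followed by an east step, and vice versa.
\<close>

definition paths_avoiding :: "nat \<Rightarrow> nat \<Rightarrow> point list set" where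
  "paths_avoiding k n = {p. delannoy_path p \<and> hd p = (0, 0) \<and> last p = (int n, int (k * n)) \<and>
     (\<forall>(x, y) \<in> set p. y \<ge> int k * x) \<and>
     \<not> sublist [north, east] (path_steps p) \<and> \<not> sublist [east, north] (path_steps p)}"

definition diag_paths_avoiding :: "nat \<Rightarrow> nat \<Rightarrow> point list set" where
  "diag_paths_avoiding k n =
     {p \<in> paths_avoiding k n. path_steps p \<noteq> [] \<and> last (path_steps p) = diag}"

definition F_gf :: "nat \<Rightarrow> rat fps" where
  "F_gf k = Abs_fps (\<lambda>n. of_nat (card (paths_avoiding k n)))"

definition FD_gf :: "nat \<Rightarrow> rat fps" where
  "FD_gf k = Abs_fps (\<lambda>n. if n \<ge> 1 then of_nat (card (diag_paths_avoiding k n)) else 0)"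

text \<open>The path sets are finite, so \<open>card\<close> really counts: each step increases \<open>x + y\<close>.\<close>

lemma path_steps_Cons2: "path_steps (a # b # p) = (b - a) # path_steps (b # p)"
  by (simp add: path_steps_def map_upt_Suc del: upt_Suc)

lemma delannoy_path_bounds:
  assumes "p \<noteq> []" "set (path_steps p) \<subseteq> {north, east, diag}"
  shows "set p \<subseteq> {fst (hd p)..fst (last p)} \<times> {snd (hd p)..snd (last p)} \<and>
    int (length p) \<le> 1 + (fst (last p) - fst (hd p)) + (snd (last p) - snd (hd p))"
  using assms
proof (induction p rule: induct_list012)
  case (3 a b p)
  then have IH: "set (b # p) \<subseteq> {fst b..fst (last (b # p))} \<times> {snd b..snd (last (b # p))}"
      "int (length (b # p)) \<le> 1 + (fst (last (b # p)) - fst b) + (snd (last (b # p)) - snd b)"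
    by (simp_all add: path_steps_Cons2)
  have ab: "fst a \<le> fst b" "snd a \<le> snd b" "fst a + snd a + 1 \<le> fst b + snd b"
    using 3(4) by (cases a; cases b; auto simp: path_steps_Cons2 north_def east_def diag_def)+
  have "fst b \<le> fst (last (b # p))" "snd b \<le> snd (last (b # p))"
    using IH(1) by (cases b; auto)+
  with IH ab show ?case by (cases a) fastforce
qed (auto simp: path_steps_def mem_Times_iff)

lemma finite_paths_avoiding: "finite (paths_avoiding k n)"
proof (rule finite_subset)
  let ?B = "{0..int n} \<times> {0..int (k * n)}"
  show "paths_avoiding k n \<subseteq> {p. set p \<subseteq> ?B \<and> length p \<le> 1 + n + k * n}"
  proof
    fix p assume "p \<in> paths_avoiding k n"
    then have p: "p \<noteq> []" "set (path_steps p) \<subseteq> {north, east, diag}"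
        "hd p = (0, 0)" "last p = (int n, int (k * n))"
      by (auto simp: paths_avoiding_def delannoy_path_def)
    from delannoy_path_bounds[OF p(1,2)]
    have "set p \<subseteq> ?B" "int (length p) \<le> int (1 + n + k * n)"
      unfolding p(3,4) by simp_all
    then show "p \<in> {p. set p \<subseteq> ?B \<and> length p \<le> 1 + n + k * n}"
      by (simp only: mem_Collect_eq of_nat_le_iff)
  qed
  show "finite {p. set p \<subseteq> ?B \<and> length p \<le> 1 + n + k * n}"
    by (rule finite_lists_length_le) simp
qed

end

theory Submission
  imports Defs
begin

text \<open>
  Give the point \<open>(x, y)\<close> the level \<open>y - 2 x\<close>, so that the steps \<open>N\<close>, \<open>D\<close>, \<open>E\<close> change the level by
  \<open>1\<close>, \<open>-1\<close>, \<open>-2\<close>. Cutting a path at the last time it leaves a level, a path ending in \<open>D\<close> is uniquely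
  \<open>a N b D\<close>, and a path ending in \<open>E\<close> is uniquely \<open>a N b N c E\<close>, where \<open>a\<close>, \<open>b\<close>, \<open>c\<close> stay
  weakly above the level at which they start and end; a cut before an \<open>N\<close> forbids a final \<open>E\<close>, and
  the cut before the final \<open>E\<close> forces \<open>c\<close> to be nonempty. With \<open>T = 1 + F\<^sub>D\<close> this reads
  \<open>T = 1 + x T F\<close> and \<open>F = T + x T\<^sup>2 (F - 1)\<close>, whence \<open>F = (1 - x) T\<^sup>2\<close> and \<open>T = 1 + z T\<^sup>3\<close> with
  \<open>z = x (1 - x)\<close>. The coefficients of the powers of \<open>T\<close> in \<open>z\<close> are the Fuss--Catalan (Raney) numbers,
  since both satisfy the recurrence encoded by \<open>T\<^bsup>p + 1\<^esup> = T\<^bsup>p\<^esup> + z T\<^bsup>p + 3\<^esup>\<close>.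
\<close>

section \<open>Raney numbers\<close>

text \<open>Fuss--Catalan numbers of order 3. The case \<open>m = 0\<close> is split off because at
  \<open>p = m = 0\<close> the quotient \<open>0 / 0\<close> would evaluate to 0, whereas
  \<open>T ^ 0\<close> has constant term 1.\<close>

definition raney :: "nat \<Rightarrow> nat \<Rightarrow> rat" where
  "raney p m = (if m = 0 then 1
     else of_nat p / of_nat (3 * m + p) * of_nat ((3 * m + p) choose m))"

text \<open>With \<open>M = 3 * m + p + 3\<close>, all three terms are rational multiples of
  \<open>M choose m\<close>, and the claim reduces to
  \<open>p * (M - m) + (p + 3) * (m + 1) = (p + 1) * M\<close>.\<close>

lemma raney_Suc: "raney (Suc p) (Suc m) = raney p (Suc m) + raney (p + 3) m"
proof -
  define M where "M = 3 * m + p + 3"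
  define C :: rat where "C = of_nat (M choose m)"
  have M: "of_nat M = (3 * of_nat m + of_nat p + 3 :: rat)" and M0: "(of_nat M :: rat) > 0"
    by (simp_all add: M_def)
  have "Suc m * (M choose Suc m) = (M - m) * (M choose m)"
    by (metis binomial_absorb_comp binomial_absorption)
  then have "of_nat (Suc m) * (of_nat (M choose Suc m) :: rat) = of_nat (M - m) * C"
    unfolding C_def by (metis of_nat_mult)
  then have 1: "(of_nat (M choose Suc m) :: rat) = (of_nat M - of_nat m) * C / (of_nat m + 1)"
    by (simp add: field_simps of_nat_diff M_def)
  have "Suc m * (Suc M choose Suc m) = Suc M * (M choose m)"
    by (rule Suc_times_binomial)
  then have "of_nat (Suc m) * (of_nat (Suc M choose Suc m) :: rat) = of_nat (Suc M) * C"
    unfolding C_def by (metis of_nat_mult)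
  then have 2: "(of_nat (Suc M choose Suc m) :: rat) = (of_nat M + 1) * C / (of_nat m + 1)"
    by (simp add: field_simps)
  have m1: "(of_nat m + 1 :: rat) > 0" by (simp add: add_nonneg_pos)
  have "raney (Suc p) (Suc m)
      = (of_nat p + 1) / (of_nat M + 1) * of_nat (Suc M choose Suc m)"
    by (simp add: raney_def M_def algebra_simps)
  also have "\<dots> = (of_nat p + 1) * C / (of_nat m + 1)"
    unfolding 2 using M0 m1 by (simp add: divide_simps)
  finally have L: "raney (Suc p) (Suc m) = (of_nat p + 1) * C / (of_nat m + 1)" .
  have R1: "raney p (Suc m) = of_nat p / of_nat M * ((of_nat M - of_nat m) * C / (of_nat m + 1))"
    unfolding 1[symmetric] by (simp add: raney_def M_def algebra_simps)
  have R2: "raney (p + 3) m = (of_nat p + 3) / of_nat M * C"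
    by (cases "m = 0") (simp_all add: raney_def M_def C_def algebra_simps)
  have "raney p (Suc m) + raney (p + 3) m
      = C * (of_nat p * (of_nat M - of_nat m) + (of_nat p + 3) * (of_nat m + 1))
        / (of_nat M * (of_nat m + 1))"
    unfolding R1 R2 using M0 m1 by (simp add: divide_simps) (simp add: algebra_simps)
  also have "of_nat p * (of_nat M - of_nat m) + (of_nat p + 3) * (of_nat m + 1)
      = (of_nat p + 1) * (of_nat M :: rat)"
    unfolding M by (simp add: algebra_simps)
  also have "C * ((of_nat p + 1) * of_nat M) / (of_nat M * (of_nat m + 1))
      = (of_nat p + 1) * C / (of_nat m + 1)"
    using M0 m1 by (simp add: divide_simps)
  finally show ?thesis unfolding L ..
qed

lemma raney_1:
  assumes "m \<ge> 1"
  shows "raney 1 m = of_nat ((3 * m) choose (m - 1)) / of_nat m"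
proof -
  obtain l where l: "m = Suc l" using assms by (cases m) auto
  have "m * (Suc (3 * m) choose m) = Suc (3 * m) * ((3 * m) choose (m - 1))"
    unfolding l using Suc_times_binomial[of l "3 * Suc l"] by simp
  then have "of_nat m * (of_nat (Suc (3 * m) choose m) :: rat)
      = of_nat (Suc (3 * m)) * of_nat ((3 * m) choose (m - 1))"
    by (metis of_nat_mult)
  then show ?thesis using assms
    by (simp add: raney_def divide_simps del: of_nat_Suc binomial_Suc_Suc) (simp add: algebra_simps)
qed

lemma raney_2: "raney 2 m = of_nat ((3 * m + 1) choose m) / of_nat (m + 1)"
proof (cases "m = 0")
  case False
  have "(3 * m + 2 - m) * ((3 * m + 2) choose m) = (3 * m + 2) * ((3 * m + 2 - 1) choose m)"
    by (rule binomial_absorb_comp)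
  then have "2 * (m + 1) * ((3 * m + 2) choose m) = (3 * m + 2) * ((3 * m + 1) choose m)"
    by simp
  then have "2 * of_nat (m + 1) * (of_nat ((3 * m + 2) choose m) :: rat)
      = of_nat (3 * m + 2) * of_nat ((3 * m + 1) choose m)"
    by (metis of_nat_mult of_nat_numeral)
  moreover have "(of_nat (m + 1) :: rat) > 0" "(of_nat (3 * m + 2) :: rat) > 0"
    by (simp_all only: of_nat_0_less_iff)
  ultimately show ?thesis using False
    by (simp add: raney_def divide_simps del: of_nat_Suc of_nat_add) (simp add: algebra_simps)
qed (simp add: raney_def)

text \<open>Both sides equal 1 at \<open>p = 0\<close> and obey the same recurrence in
  \<open>p\<close>. That recurrence also involves the exponent \<open>p + 3\<close>, so the outer
  induction runs over the coefficient index, for all exponents at once.\<close>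

lemma power_eq_raney_compose:
  fixes T z :: "rat fps"
  assumes T: "T = 1 + z * T ^ 3" and z0: "fps_nth z 0 = 0"
  shows "T ^ p = Abs_fps (raney p) oo z"
proof -
  define B where "B p = Abs_fps (raney p) oo z" for p
  have A: "Abs_fps (raney (Suc p)) = Abs_fps (raney p) + fps_X * Abs_fps (raney (p + 3))" for p
  proof (rule fps_ext)
    fix m show "fps_nth (Abs_fps (raney (Suc p))) m =
        fps_nth (Abs_fps (raney p) + fps_X * Abs_fps (raney (p + 3))) m"
      using raney_Suc by (cases m) (simp_all add: raney_def[of _ 0])
  qed
  have B_Suc: "B (Suc p) = B p + z * B (p + 3)" for p
    using z0 by (simp add: B_def A fps_compose_add_distrib fps_compose_mult_distrib)
  have "Abs_fps (raney 0) = 1" by (rule fps_ext) (simp add: raney_def)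
  then have B_0: "B 0 = 1" by (simp add: B_def)
  have T_Suc: "T ^ Suc p = T ^ p + z * T ^ (p + 3)" for p
  proof -
    have "T ^ Suc p = T ^ p * T" by simp
    also have "\<dots> = T ^ p * (1 + z * T ^ 3)" using T by simp
    finally show ?thesis by (simp add: algebra_simps power_add)
  qed
  have "fps_nth (T ^ p) n = fps_nth (B p) n" for n
  proof (induction n arbitrary: p rule: less_induct)
    case (less n)
    \<comment> \<open>The summand \<open>i = 0\<close> vanishes with the constant term of
      \<open>z\<close>; the others have index \<open>n - i < n\<close>, where the outer hypothesis
      covers every \<open>q\<close>.\<close>
    have z_mult: "fps_nth (z * T ^ q) n = fps_nth (z * B q) n" for q
      unfolding fps_mult_nth
    proof (rule sum.cong[OF refl])
      fix i assume "i \<in> {0..n}"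
      then show "fps_nth z i * fps_nth (T ^ q) (n - i) = fps_nth z i * fps_nth (B q) (n - i)"
        using z0 less[of "n - i" q] by (cases "i = 0") auto
    qed
    show ?case
    proof (induction p)
      case (Suc p)
      then show ?case unfolding T_Suc B_Suc by (simp add: z_mult)
    qed (simp add: B_0)
  qed
  then show ?thesis unfolding B_def by (intro fps_ext)
qed

text \<open>For \<open>m > n\<close> the truncated difference \<open>n - m\<close> would be 0 and
  the right-hand side 1, although the coefficient is 0.\<close>

lemma fps_nth_X_power_one_minus_X_power:
  assumes "m \<le> n"
  shows "fps_nth (fps_X ^ m * (1 - fps_X) ^ j) n
    = (-1) ^ (n - m) * (of_nat (j choose (n - m)) :: 'a :: comm_ring_1)"
proof -
  have "(1 - fps_X) ^ j = (\<Sum>k\<le>j. of_nat (j choose k) * (- fps_X :: 'a fps) ^ k)"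
    using binomial_ring[of "- fps_X :: 'a fps" 1 j] by simp
  also have "\<dots> = (\<Sum>k\<le>j. fps_const ((-1) ^ k * of_nat (j choose k)) * fps_X ^ k)"
  proof (rule sum.cong[OF refl])
    fix k
    have "(- fps_X :: 'a fps) ^ k = fps_const ((-1) ^ k) * fps_X ^ k"
      by (subst power_minus) (simp flip: fps_const_power fps_const_neg)
    then show "of_nat (j choose k) * (- fps_X :: 'a fps) ^ k
        = fps_const ((-1) ^ k * of_nat (j choose k)) * fps_X ^ k"
      by (simp add: fps_of_nat[symmetric] mult_ac flip: fps_const_mult)
  qed
  finally have "fps_nth ((1 - fps_X :: 'a fps) ^ j) i = (-1) ^ i * of_nat (j choose i)" for i
    by (simp add: fps_sum_nth if_distrib [of "(*) _"] sum.delta binomial_eq_0 cong: if_cong)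
  then show ?thesis using assms by (simp add: fps_X_power_mult_nth)
qed

section \<open>Generating functions of weighted sets\<close>

definition gf :: "('a \<Rightarrow> nat) \<Rightarrow> 'a set \<Rightarrow> rat fps" where
  "gf f A = Abs_fps (\<lambda>n. of_nat (card {x \<in> A. f x = n}))"

text \<open>Since \<open>card\<close> is 0 on infinite sets, the sum and product rules for
  \<open>gf\<close> are stated under this condition.\<close>

definition finite_fibers :: "('a \<Rightarrow> nat) \<Rightarrow> 'a set \<Rightarrow> bool" where
  "finite_fibers f A \<longleftrightarrow> (\<forall>n. finite {x \<in> A. f x = n})"

lemma finite_fibers_subset: "finite_fibers f B \<Longrightarrow> A \<subseteq> B \<Longrightarrow> finite_fibers f A"
  unfolding finite_fibers_def by (blast intro: finite_subset[rotated])

lemma fiber_Times: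
  "{x \<in> A \<times> B. (case x of (a, b) \<Rightarrow> f a + g b) = n}
    = (\<Union>i\<in>{0..n}. {a \<in> A. f a = i} \<times> {b \<in> B. g b = n - i})" for n :: nat
  by auto

lemma finite_fibers_Times:
  assumes "finite_fibers f A" "finite_fibers g B"
  shows "finite_fibers (\<lambda>(a, b). f a + g b) (A \<times> B)"
  using assms unfolding finite_fibers_def fiber_Times by blast

lemma gf_Times:
  assumes "finite_fibers f A" "finite_fibers g B"
  shows "gf (\<lambda>(a, b). f a + g b) (A \<times> B) = gf f A * gf g B"
proof (rule fps_ext)
  fix n
  have "card (\<Union>i\<in>{0..n}. {a \<in> A. f a = i} \<times> {b \<in> B. g b = n - i})
      = (\<Sum>i\<in>{0..n}. card ({a \<in> A. f a = i} \<times> {b \<in> B. g b = n - i}))"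
    using assms by (intro card_UN_disjoint) (auto simp: finite_fibers_def)
  then show "fps_nth (gf (\<lambda>(a, b). f a + g b) (A \<times> B)) n = fps_nth (gf f A * gf g B) n"
    by (simp add: gf_def fiber_Times fps_mult_nth card_cartesian_product)
qed

lemma gf_Un:
  assumes "finite_fibers f A" "finite_fibers f B" "A \<inter> B = {}"
  shows "gf f (A \<union> B) = gf f A + gf f B"
proof (rule fps_ext)
  fix n
  have "{x \<in> A \<union> B. f x = n} = {x \<in> A. f x = n} \<union> {x \<in> B. f x = n}" by auto
  moreover have "card \<dots> = card {x \<in> A. f x = n} + card {x \<in> B. f x = n}"
    using assms by (intro card_Un_disjoint) (auto simp: finite_fibers_def)
  ultimately show "fps_nth (gf f (A \<union> B)) n = fps_nth (gf f A + gf f B) n"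
    by (simp add: gf_def)
qed

lemma gf_singleton: "f a = 0 \<Longrightarrow> gf f {a} = 1"
  by (rule fps_ext) (simp add: gf_def Collect_conv_if)

text \<open>Source of each factor x in the functional equations: the decompositions below are
  injective and add exactly one step of weight 1, the final \<open>diag\<close> or
  \<open>east\<close>.\<close>

lemma gf_image_Suc:
  assumes "inj_on h A" "\<And>x. x \<in> A \<Longrightarrow> g (h x) = Suc (f x)"
  shows "gf g (h ` A) = fps_X * gf f A"
proof (rule fps_ext)
  fix n
  show "fps_nth (gf g (h ` A)) n = fps_nth (fps_X * gf f A) n"
  proof (cases n)
    case 0
    then have "{y \<in> h ` A. g y = n} = {}" using assms(2) by auto
    then have "card {y \<in> h ` A. g y = n} = 0" by (simp only: card.empty)
    then show ?thesis using 0 by (simp add: gf_def)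
  next
    case (Suc m)
    have "{y \<in> h ` A. g y = n} = h ` {x \<in> A. f x = m}"
      using assms(2) Suc by auto
    moreover have "card \<dots> = card {x \<in> A. f x = m}"
      by (rule card_image, rule inj_on_subset[OF assms(1)]) auto
    ultimately show ?thesis by (simp add: gf_def Suc)
  qed
qed

section \<open>Step words\<close>

definition level :: "point \<Rightarrow> int" where "level s = snd s - 2 * fst s"

abbreviation height :: "point list \<Rightarrow> int" where
  "height w \<equiv> (\<Sum>s\<leftarrow>w. level s)"

text \<open>Steps \<open>east\<close> and \<open>diag\<close> each advance x by one, so this is the
  x-coordinate of the endpoint.\<close>

definition weight :: "point list \<Rightarrow> nat" where
  "weight w = length (filter (\<lambda>s. s \<noteq> north) w)"

text \<open>The starting level \<open>h\<close> itself is not tested, only the levels reached after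
  each step.\<close>

fun nonneg_from :: "int \<Rightarrow> point list \<Rightarrow> bool" where
  "nonneg_from h [] \<longleftrightarrow> True"
| "nonneg_from h (s # w) \<longleftrightarrow> h + level s \<ge> 0 \<and> nonneg_from (h + level s) w"

definition compatible :: "point \<Rightarrow> point \<Rightarrow> bool" where
  "compatible s t \<longleftrightarrow> \<not> (s = north \<and> t = east) \<and> \<not> (s = east \<and> t = north)"

definition words :: "point list set" where
  "words = {w. set w \<subseteq> {north, east, diag} \<and> nonneg_from 0 w \<and> height w = 0 \<and>
     successively compatible w}"

definition diag_words :: "point list set" where
  "diag_words = {w \<in> words. w \<noteq> [] \<and> last w = diag}"

lemma level_step [simp]: "level north = 1" "level east = -2" "level diag = -1"
  by (simp_all add: level_def north_def east_def diag_def)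

lemma step_neq [simp]:
  "north \<noteq> east" "north \<noteq> diag" "east \<noteq> north" "east \<noteq> diag" "diag \<noteq> north" "diag \<noteq> east"
  by (simp_all add: north_def east_def diag_def)

lemma weight_simps [simp]:
  "weight [] = 0" "weight (s # w) = (if s = north then 0 else 1) + weight w"
  "weight (v @ w) = weight v + weight w"
  by (simp_all add: weight_def)

section \<open>Nonnegative words and their last departure from level 0\<close>

lemma nonneg_from_append [simp]:
  "nonneg_from h (v @ w) \<longleftrightarrow> nonneg_from h v \<and> nonneg_from (h + height v) w"
  by (induction v arbitrary: h) (auto simp: add.assoc)

lemma nonneg_from_mono: "nonneg_from h w \<Longrightarrow> h \<le> h' \<Longrightarrow> nonneg_from h' w"
  by (induction w arbitrary: h h') force+

lemma nonneg_from_height: "nonneg_from h w \<Longrightarrow> h \<ge> 0 \<Longrightarrow> h + height w \<ge> 0"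
  by (induction w arbitrary: h) force+

text \<open>Induction on the last step \<open>s\<close>. If the level was already positive before
  \<open>s\<close>, the earlier cut survives: the total height is at least 1, so
  \<open>b @ [s]\<close> still ends at or above 0. Otherwise the level was 0, \<open>s\<close> must
  be \<open>north\<close>, and the cut is made there.\<close>

lemma last_departure:
  assumes "set w \<subseteq> {north, east, diag}" "nonneg_from 0 w" "height w \<ge> 1"
  shows "\<exists>a b. w = a @ north # b \<and> height a = 0 \<and> nonneg_from 0 a \<and> nonneg_from 0 b"
  using assms
proof (induction w rule: rev_induct)
  case (snoc s v)
  show ?case
  proof (cases "height v \<ge> 1")
    case True
    then obtain a b where "v = a @ north # b" "height a = 0" "nonneg_from 0 a" "nonneg_from 0 b"
      using snoc by auto
    then show ?thesis using snoc.prems by (intro exI[of _ a] exI[of _ "b @ [s]"]) auto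
  next
    case False
    moreover have "height v \<ge> 0" using nonneg_from_height[of 0 v] snoc.prems by simp
    ultimately have "height v = 0" by simp
    moreover from this have "s = north" using snoc.prems by auto
    ultimately show ?thesis using snoc.prems by (intro exI[of _ v] exI[of _ "[]"]) auto
  qed
qed simp

text \<open>Of two different cuts, the later one lies inside the tail of the earlier one, and the
  piece \<open>c\<close> between them would have height -1, against nonnegativity of that
  tail.\<close>

lemma last_departure_unique:
  assumes "a @ north # b = a' @ north # b'" "height a = 0" "height a' = 0"
    "nonneg_from 0 b" "nonneg_from 0 b'"
  shows "a = a' \<and> b = b'"
proof -
  have *: False if "a' @ north # b' = (a' @ north # c) @ north # b" "height (a' @ north # c) = 0"
      "height a' = 0" "nonneg_from 0 b'" for a' b' c b
  proof -
    have "nonneg_from 0 c" using that by simp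
    then show False using nonneg_from_height[of 0 c] that by simp
  qed
  obtain us where "a = a' @ us \<and> us @ north # b = north # b' \<or>
      a @ us = a' \<and> north # b = us @ north # b'"
    using assms(1) by (auto simp: append_eq_append_conv2)
  then show ?thesis
  proof (elim disjE conjE)
    assume "a = a' @ us" "us @ north # b = north # b'"
    then show ?thesis using *[of a' b' _ b] assms by (cases us) auto
  next
    assume "a @ us = a'" "north # b = us @ north # b'"
    then show ?thesis using *[of a b _ b'] assms by (cases us) auto
  qed
qed

section \<open>Decomposition of words according to their last step\<close>

lemma Nil_in_words [simp]: "[] \<in> words"
  by (simp add: words_def)

text \<open>Before a final \<open>north\<close> the height would be -1.\<close>

lemma words_last:
  assumes "w \<in> words" "w \<noteq> []"
  shows "last w = east \<or> last w = diag"
proof -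
  obtain v s where w: "w = v @ [s]" using assms(2) by (metis append_butlast_last_id)
  then have "s \<in> {north, east, diag}" "height v \<ge> 0"
    using assms(1) nonneg_from_height[of 0 v] by (auto simp: words_def)
  moreover have "s \<noteq> north" using assms(1) w \<open>height v \<ge> 0\<close> by (auto simp: words_def)
  ultimately show ?thesis using w by auto
qed

lemma nonneg_from_hd: "nonneg_from 0 w \<Longrightarrow> w \<noteq> [] \<Longrightarrow> level (hd w) \<ge> 0"
  by (cases w) auto

lemma words_hd: "w \<in> words \<Longrightarrow> w \<noteq> [] \<Longrightarrow> hd w \<noteq> east"
  using nonneg_from_hd[of w] by (auto simp: words_def)

lemma diag_words_subset: "diag_words \<subseteq> words"
  by (auto simp: diag_words_def)

text \<open>The \<open>north\<close> following \<open>a\<close> forbids a final \<open>east\<close>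
  in \<open>a\<close>, and a word returning to level 0 cannot end in \<open>north\<close>; only
  \<open>diag\<close> or emptiness is left.\<close>

lemma prefix_diag_words:
  assumes "a @ north # b = w" "successively compatible w" "set w \<subseteq> {north, east, diag}"
    "height a = 0" "nonneg_from 0 a"
  shows "a \<in> insert [] diag_words"
proof (cases "a = []")
  case False
  have "a \<in> words" using assms by (auto simp: words_def successively_append_iff)
  moreover have "last a \<noteq> east"
    using assms False by (auto simp: successively_append_iff compatible_def)
  ultimately show ?thesis using words_last[of a] False by (auto simp: diag_words_def)
qed simp

text \<open>Without its final \<open>diag\<close> the word has height 1 and is cut once. The factor
  \<open>b\<close> is unrestricted: it never starts with \<open>east\<close>, and any step may
  precede \<open>diag\<close>.\<close>

lemma diag_words_decomp:
  "diag_words = (\<lambda>(a, b). a @ north # b @ [diag]) ` (insert [] diag_words \<times> words)"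
proof (intro subset_antisym subsetI)
  fix w assume w: "w \<in> diag_words"
  then obtain v where v: "w = v @ [diag]" unfolding diag_words_def
    by (metis (mono_tags, lifting) append_butlast_last_id mem_Collect_eq)
  have "set v \<subseteq> {north, east, diag}" "nonneg_from 0 v" "height v = 1" "successively compatible v"
    using w by (auto simp: diag_words_def words_def v successively_append_iff)
  moreover from this obtain a b where ab: "v = a @ north # b" "height a = 0" "nonneg_from 0 a"
      "nonneg_from 0 b" using last_departure[of v] by auto
  ultimately have "b \<in> words" "a \<in> insert [] diag_words"
    using prefix_diag_words[of a b v]
    by (auto simp: words_def successively_append_iff successively_Cons)
  then show "w \<in> (\<lambda>(a, b). a @ north # b @ [diag]) ` (insert [] diag_words \<times> words)"
    unfolding v ab by force
next
  fix w assume "w \<in> (\<lambda>(a, b). a @ north # b @ [diag]) ` (insert [] diag_words \<times> words)"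
  then obtain a b where ab: "w = a @ north # b @ [diag]" "a \<in> insert [] diag_words" "b \<in> words"
    by auto
  then have "a \<in> words" "a \<noteq> [] \<Longrightarrow> last a = diag" by (auto simp: diag_words_def)
  then show "w \<in> diag_words"
    using ab(1,3) words_hd[of b] nonneg_from_mono[of 0 b 1]
    by (cases "b = []")
      (auto simp: diag_words_def words_def successively_append_iff successively_Cons compatible_def)
qed

text \<open>Without its final \<open>east\<close> the word has height 2, so it is cut at its last
  departures from levels 0 and 1 in turn.\<close>

lemma east_words_decomp:
  "words - insert [] diag_words = (\<lambda>((a, b), c). a @ north # b @ north # c @ [east]) `
     ((insert [] diag_words \<times> insert [] diag_words) \<times> (words - {[]}))"
    (is "?L = ?f ` ?R")
proof (intro subset_antisym subsetI)
  fix w assume w: "w \<in> ?L"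
  then have "w \<noteq> []" "last w = east" using words_last[of w] by (auto simp: diag_words_def)
  then obtain v where v: "w = v @ [east]" by (metis append_butlast_last_id)
  have v': "set v \<subseteq> {north, east, diag}" "nonneg_from 0 v" "height v = 2"
      "successively compatible v" "v \<noteq> []" "last v \<noteq> north"
    using w by (auto simp: words_def v successively_append_iff compatible_def)
  then obtain a u where au: "v = a @ north # u" "height a = 0" "nonneg_from 0 a" "nonneg_from 0 u"
    using last_departure[of v] by auto
  then have u: "set u \<subseteq> {north, east, diag}" "height u = 1" "successively compatible u"
    using v' by (auto simp: successively_append_iff successively_Cons)
  then obtain b c where bc: "u = b @ north # c" "height b = 0" "nonneg_from 0 b" "nonneg_from 0 c"
    using last_departure[of u] au by auto
  \<comment> \<open>An empty \<open>c\<close> would make \<open>north\<close> the last step of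
    \<open>v\<close>, a peak with the final \<open>east\<close>.\<close>
  have "c \<in> words - {[]}" using u bc v' au
    by (auto simp: words_def successively_append_iff successively_Cons)
  moreover have "a \<in> insert [] diag_words" "b \<in> insert [] diag_words"
    using prefix_diag_words[OF au(1)[symmetric] v'(4,1) au(2,3)]
      prefix_diag_words[OF bc(1)[symmetric] u(3,1) bc(2,3)] by blast+
  ultimately have "((a, b), c) \<in> ?R" by blast
  then show "w \<in> ?f ` ?R" unfolding v au bc by (rule rev_image_eqI) simp
next
  fix w assume "w \<in> ?f ` ?R"
  then obtain a b c where abc: "w = a @ north # b @ north # c @ [east]"
      "a \<in> insert [] diag_words" "b \<in> insert [] diag_words" "c \<in> words" "c \<noteq> []"
    by auto
  have a: "a \<in> words" "a \<noteq> [] \<Longrightarrow> last a = diag" and b: "b \<in> words" "b \<noteq> [] \<Longrightarrow> last b = diag"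
    using abc by (auto simp: diag_words_def)
  have "nonneg_from 1 b" "nonneg_from 2 c"
    using b abc nonneg_from_mono[of 0] by (auto simp: words_def)
  moreover have "successively compatible (b @ north # c @ [east])"
    using b abc words_hd[of c] words_last[of c]
    by (auto simp: words_def successively_append_iff successively_Cons compatible_def)
  \<comment> \<open>This settles the junction after the first \<open>north\<close>, including empty
    \<open>b\<close>, where another \<open>north\<close> follows.\<close>
  moreover have "hd (b @ north # c @ [east]) \<noteq> east"
    using words_hd[of b] b by (cases b) auto
  ultimately have "w \<in> words"
    using a b abc unfolding words_def
    by (auto simp: successively_append_iff successively_Cons compatible_def)
  then show "w \<in> ?L" by (simp add: abc(1) diag_words_def)
qed

lemma inj_on_diag_decomp:
  "inj_on (\<lambda>(a, b). a @ north # b @ [diag]) (insert [] diag_words \<times> words)"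
proof (rule inj_onI; clarify)
  fix a b a' b'
  assume *: "a \<in> insert [] diag_words" "a' \<in> insert [] diag_words" "b \<in> words" "b' \<in> words"
    "a @ north # b @ [diag] = a' @ north # b' @ [diag]"
  then have "(a @ north # b) @ [diag] = (a' @ north # b') @ [diag]" by simp
  then have "a @ north # b = a' @ north # b'" by blast
  then show "a = a' \<and> b = b'"
    using * last_departure_unique[of a b a' b'] by (auto simp: diag_words_def words_def)
qed

lemma inj_on_east_decomp:
  "inj_on (\<lambda>((a, b), c). a @ north # b @ north # c @ [east])
     ((insert [] diag_words \<times> insert [] diag_words) \<times> (words - {[]}))"
    (is "inj_on ?f ?R")
proof (rule inj_onI)
  fix x y assume xy: "x \<in> ?R" "y \<in> ?R" "?f x = ?f y"
  obtain a b c a' b' c' where eqs: "x = ((a, b), c)" "y = ((a', b'), c')"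
    by (metis prod.exhaust)
  have *: "a \<in> insert [] diag_words" "a' \<in> insert [] diag_words" "b \<in> insert [] diag_words"
    "b' \<in> insert [] diag_words" "c \<in> words" "c' \<in> words"
    "a @ north # b @ north # c @ [east] = a' @ north # b' @ north # c' @ [east]"
    using xy unfolding eqs mem_Times_iff by (simp_all only: fst_conv snd_conv prod.case) auto
  then have "(a @ north # b @ north # c) @ [east] = (a' @ north # b' @ north # c') @ [east]"
    by simp
  then have eq: "a @ north # b @ north # c = a' @ north # b' @ north # c'" by blast
  have w: "a \<in> words" "a' \<in> words" "b \<in> words" "b' \<in> words"
    using * by (auto simp: diag_words_def)
  \<comment> \<open>Relative to the first cut, \<open>c\<close> starts at level 1; hence the whole
    tail \<open>b @ north # c\<close> is nonnegative, as uniqueness of that cut requires.\<close>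
  then have "nonneg_from 1 c" "nonneg_from 1 c'"
    using * nonneg_from_mono[of 0] by (auto simp: words_def)
  then have 1: "a = a' \<and> b @ north # c = b' @ north # c'"
    using last_departure_unique[OF eq] w by (auto simp: words_def)
  then have "b = b' \<and> c = c'"
    using last_departure_unique[of b c b' c'] w * by (auto simp: words_def)
  with 1 show "x = y" by (simp add: eqs)
qed

section \<open>From lattice paths to step words\<close>

text \<open>Inverse of \<open>path_steps\<close> once the initial vertex is fixed.\<close>

fun vertices :: "point \<Rightarrow> point list \<Rightarrow> point list" where
  "vertices a [] = [a]"
| "vertices a (s # w) = a # vertices (a + s) w"

lemma vertices_ne [simp]: "vertices a w \<noteq> []" and hd_vertices [simp]: "hd (vertices a w) = a"
  by (cases w; simp)+

lemma path_steps_singleton [simp]: "path_steps [a] = []"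
  by (simp add: path_steps_def)

lemma path_steps_vertices [simp]: "path_steps (vertices a w) = w"
proof (induction w arbitrary: a)
  case (Cons s w)
  obtain q where q: "vertices (a + s) w = (a + s) # q"
    by (metis hd_vertices list.collapse vertices_ne)
  with Cons[of "a + s"] show ?case by (simp add: path_steps_Cons2)
qed simp

lemma vertices_path_steps: "p \<noteq> [] \<Longrightarrow> vertices (hd p) (path_steps p) = p"
  by (induction p rule: induct_list012) (simp_all add: path_steps_Cons2)

lemma last_vertices: "last (vertices a w) = a + sum_list w"
  by (induction w arbitrary: a) (simp_all add: add.assoc)

lemma vertices_above:
  "(\<forall>(x, y) \<in> set (vertices a w). y \<ge> int 2 * x) \<longleftrightarrow> level a \<ge> 0 \<and> nonneg_from (level a) w"
proof (induction w arbitrary: a)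
  case (Cons s w)
  have "level (a + s) = level a + level s" by (simp add: level_def)
  moreover have "(\<forall>(x, y) \<in> set (vertices a (s # w)). y \<ge> int 2 * x) \<longleftrightarrow>
      level a \<ge> 0 \<and> (\<forall>(x, y) \<in> set (vertices (a + s) w). y \<ge> int 2 * x)"
    by (auto simp: level_def)
  ultimately show ?case unfolding Cons by simp
qed (auto simp: level_def)

text \<open>Turns a forbidden factor into a condition on neighbours, which splits over
  concatenations.\<close>

lemma sublist_pair_iff: "sublist [s, t] w \<longleftrightarrow> \<not> successively (\<lambda>x y. \<not> (x = s \<and> y = t)) w"
  by (induction w rule: induct_list012) (auto simp: sublist_Cons_right)

lemma successively_compatible_iff:
  "successively compatible w \<longleftrightarrow> \<not> sublist [north, east] w \<and> \<not> sublist [east, north] w"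
  unfolding sublist_pair_iff compatible_def
  by (induction w rule: induct_list012) auto

text \<open>Ending at \<open>(n, 2 * n)\<close> thus means weight \<open>n\<close> and height
  0.\<close>

lemma sum_list_steps:
  "set w \<subseteq> {north, east, diag} \<Longrightarrow>
     sum_list w = (int (weight w), int (2 * weight w) + height w)"
  by (induction w) (auto simp: north_def east_def diag_def level_def zero_prod_def)

lemma vertices_in_paths_avoiding:
  "vertices (0, 0) w \<in> paths_avoiding 2 n \<longleftrightarrow> w \<in> words \<and> weight w = n"
proof (cases "set w \<subseteq> {north, east, diag}")
  case True
  have "level (0, 0) = 0" by (simp add: level_def)
  then have "(\<forall>(x, y) \<in> set (vertices (0, 0) w). y \<ge> int 2 * x) \<longleftrightarrow> nonneg_from 0 w"
    unfolding vertices_above by simp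
  with True show ?thesis
    unfolding paths_avoiding_def words_def delannoy_path_def successively_compatible_iff
    by (auto simp: last_vertices sum_list_steps)
qed (simp add: paths_avoiding_def words_def delannoy_path_def)

lemma paths_avoiding_hd: "p \<in> paths_avoiding k n \<Longrightarrow> p \<noteq> [] \<and> hd p = (0, 0)"
  by (simp add: paths_avoiding_def delannoy_path_def)

lemma paths_avoiding_eq: "paths_avoiding 2 n = vertices (0, 0) ` {w \<in> words. weight w = n}"
proof (intro subset_antisym subsetI)
  fix p assume p: "p \<in> paths_avoiding 2 n"
  then have "vertices (0, 0) (path_steps p) = p"
    using vertices_path_steps[of p] paths_avoiding_hd[of p] by simp
  then show "p \<in> vertices (0, 0) ` {w \<in> words. weight w = n}"
    using p vertices_in_paths_avoiding[of "path_steps p" n] by force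
qed (auto simp: vertices_in_paths_avoiding)

lemma diag_paths_avoiding_eq:
  "diag_paths_avoiding 2 n = vertices (0, 0) ` {w \<in> diag_words. weight w = n}"
  unfolding diag_paths_avoiding_def paths_avoiding_eq diag_words_def by auto

lemma inj_vertices: "inj_on (vertices a) A"
  by (metis inj_on_inverseI path_steps_vertices)

lemma F_gf_2: "F_gf 2 = gf weight words"
  by (simp add: F_gf_def gf_def paths_avoiding_eq card_image inj_vertices)

text \<open>The coefficient at 0, set to 0 by definition, agrees because a word ending in
  \<open>diag\<close> has positive weight.\<close>

lemma FD_gf_2: "FD_gf 2 = gf weight diag_words"
proof -
  have "diag \<in> set w" if "w \<in> diag_words" for w
    using that by (metis (mono_tags, lifting) diag_words_def last_in_set mem_Collect_eq)
  then have "weight w \<noteq> 0" if "w \<in> diag_words" for w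
    using that by (force simp: weight_def filter_empty_conv)
  then show ?thesis
    by (intro fps_ext)
      (auto simp: FD_gf_def gf_def diag_paths_avoiding_eq card_image inj_vertices not_le card_eq_0_iff)
qed

lemma finite_fibers_words: "finite_fibers weight words"
  unfolding finite_fibers_def
  using finite_paths_avoiding[of 2] by (simp add: paths_avoiding_eq finite_image_iff inj_vertices)

lemmas finite_fibers_subset_words = finite_fibers_subset[OF finite_fibers_words]

section \<open>The functional equations\<close>

lemma finite_fibers_insert_diag_words: "finite_fibers weight (insert [] diag_words)"
  using diag_words_subset by (intro finite_fibers_subset_words) auto

lemma gf_insert_diag_words: "gf weight (insert [] diag_words) = 1 + FD_gf 2"
proof -
  have "gf weight ({[]} \<union> diag_words) = gf weight {[]} + gf weight diag_words"
    using diag_words_subset by (intro gf_Un finite_fibers_subset_words) (auto simp: diag_words_def)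
  then show ?thesis by (simp add: gf_singleton FD_gf_2)
qed

lemma gf_words_nonempty: "gf weight (words - {[]}) = F_gf 2 - 1"
proof -
  have "gf weight ({[]} \<union> (words - {[]})) = gf weight {[]} + gf weight (words - {[]})"
    by (intro gf_Un finite_fibers_subset_words) auto
  then show ?thesis by (simp add: gf_singleton F_gf_2 insert_absorb)
qed

lemma FD_gf_eq: "FD_gf 2 = fps_X * ((1 + FD_gf 2) * F_gf 2)"
proof -
  have "gf weight diag_words =
      fps_X * gf (\<lambda>(a, b). weight a + weight b) (insert [] diag_words \<times> words)"
    by (subst diag_words_decomp, rule gf_image_Suc[OF inj_on_diag_decomp]) auto
  then show ?thesis
    using gf_Times[OF finite_fibers_insert_diag_words finite_fibers_words]
    by (simp add: FD_gf_2[symmetric] F_gf_2[symmetric] gf_insert_diag_words)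
qed

text \<open>Words that are empty or end in \<open>diag\<close> contribute
  \<open>1 + FD_gf 2\<close>; those ending in \<open>east\<close> contribute the triple
  product.\<close>

lemma F_gf_eq: "F_gf 2 = 1 + FD_gf 2 + fps_X * ((1 + FD_gf 2) ^ 2 * (F_gf 2 - 1))"
proof -
  let ?T = "insert [] diag_words" and ?g = "\<lambda>(a, b). weight a + weight b"
  have "gf weight (?T \<union> (words - ?T)) = gf weight ?T + gf weight (words - ?T)"
    by (intro gf_Un finite_fibers_insert_diag_words finite_fibers_subset_words) auto
  also have "?T \<union> (words - ?T) = words" using diag_words_subset by auto
  also have "gf weight (words - ?T) =
      fps_X * gf (\<lambda>(x, c). ?g x + weight c) ((?T \<times> ?T) \<times> (words - {[]}))"
    by (subst east_words_decomp, rule gf_image_Suc[OF inj_on_east_decomp]) auto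
  also have "gf (\<lambda>(x, c). ?g x + weight c) ((?T \<times> ?T) \<times> (words - {[]}))
      = gf weight ?T * gf weight ?T * gf weight (words - {[]})"
    by (simp only: gf_Times finite_fibers_Times finite_fibers_insert_diag_words
      finite_fibers_subset_words[OF Diff_subset])
  finally show ?thesis
    by (simp add: F_gf_2[symmetric] gf_insert_diag_words gf_words_nonempty power2_eq_square)
qed

section \<open>Solving the functional equations and extracting coefficients\<close>

theorem theorem6:
  fixes n :: nat
  shows "fps_nth (F_gf 2) n =
           (\<Sum>m = 0..n. (-1) ^ (n - m) / of_nat (m + 1) *
              of_nat ((3 * m + 1) choose m) * of_nat ((m + 1) choose (n - m))) \<and>
         fps_nth (FD_gf 2) n =
           (\<Sum>m = 1..n. (-1) ^ (n - m) / of_nat m *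
              of_nat ((3 * m) choose (m - 1)) * of_nat (m choose (n - m)))"
proof
  define T where "T = 1 + FD_gf 2"
  define z :: "rat fps" where "z = fps_X * (1 - fps_X)"
  have T1: "T = 1 + fps_X * (T * F_gf 2)" using FD_gf_eq by (simp add: T_def)
  have F1: "F_gf 2 = T + fps_X * (T ^ 2 * (F_gf 2 - 1))" using F_gf_eq by (simp add: T_def)
  \<comment> \<open>Grouped so that \<open>fps_X * (T * F_gf 2)\<close> can be replaced by
    \<open>T - 1\<close>, which eliminates \<open>F_gf 2\<close> from the right-hand side.\<close>
  have "F_gf 2 = T + T * (fps_X * (T * F_gf 2)) - fps_X * T ^ 2"
    by (subst F1) (simp add: algebra_simps power2_eq_square)
  also have "fps_X * (T * F_gf 2) = T - 1" using T1 by (simp add: algebra_simps)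
  finally have F: "F_gf 2 = (1 - fps_X) * T ^ 2" by (simp add: algebra_simps power2_eq_square)
  have "T = 1 + z * T ^ 3"
    using T1 unfolding F by (simp add: z_def algebra_simps power2_eq_square power3_eq_cube)
  then have Tpow: "T ^ p = Abs_fps (raney p) oo z" for p
    by (rule power_eq_raney_compose) (simp add: z_def)

  have z_nth: "fps_nth (z ^ m) n = (-1) ^ (n - m) * of_nat (m choose (n - m))"
      if "m \<le> n" for m n
    using that by (simp add: z_def power_mult_distrib fps_nth_X_power_one_minus_X_power)

  show "fps_nth (FD_gf 2) n = (\<Sum>m = 1..n. (-1) ^ (n - m) / of_nat m *
      of_nat ((3 * m) choose (m - 1)) * of_nat (m choose (n - m)))"
  proof -
    have "FD_gf 2 = T ^ 1 - 1" by (simp add: T_def)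
    then have "fps_nth (FD_gf 2) n = (\<Sum>m = 0..n. raney 1 m * fps_nth (z ^ m) n) - fps_nth 1 n"
      unfolding Tpow by (simp add: fps_compose_nth)
    \<comment> \<open>The summand \<open>m = 0\<close> is the coefficient of
      \<open>z ^ 0 = 1\<close> and cancels the subtracted 1.\<close>
    also have "\<dots> = (\<Sum>m = 1..n. raney 1 m * fps_nth (z ^ m) n)"
      by (simp add: sum.atLeast_Suc_atMost raney_def[of _ 0])
    also have "\<dots> = (\<Sum>m = 1..n. (-1) ^ (n - m) / of_nat m *
        of_nat ((3 * m) choose (m - 1)) * of_nat (m choose (n - m)))"
      by (intro sum.cong refl) (simp add: raney_1[unfolded One_nat_def] z_nth)
    finally show ?thesis .
  qed

  show "fps_nth (F_gf 2) n = (\<Sum>m = 0..n. (-1) ^ (n - m) / of_nat (m + 1) *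
      of_nat ((3 * m + 1) choose m) * of_nat ((m + 1) choose (n - m)))"
  proof -
    \<comment> \<open>As \<open>z ^ m\<close> has no terms below degree \<open>m\<close>, the range
      of \<open>m\<close> extends to a bound independent of \<open>i\<close>, so the two sums can be
      exchanged.\<close>
    have trunc: "fps_nth (T ^ 2) i = (\<Sum>m = 0..n. raney 2 m * fps_nth (z ^ m) i)" if "i \<le> n" for i
    proof -
      have "fps_nth (z ^ m) i = 0" if "i < m" for m
        using that by (simp add: z_def power_mult_distrib fps_X_power_mult_nth)
      then have "(\<Sum>m = 0..i. raney 2 m * fps_nth (z ^ m) i)
          = (\<Sum>m = 0..n. raney 2 m * fps_nth (z ^ m) i)"
        using that by (intro sum.mono_neutral_left) auto
      then show ?thesis by (simp add: Tpow fps_compose_nth)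
    qed
    have "fps_nth (F_gf 2) n
        = (\<Sum>i = 0..n. fps_nth (1 - fps_X) i * (\<Sum>m = 0..n. raney 2 m * fps_nth (z ^ m) (n - i)))"
      by (simp add: F fps_mult_nth trunc)
    also have "\<dots> = (\<Sum>m = 0..n. raney 2 m * fps_nth ((1 - fps_X) * z ^ m) n)"
      unfolding fps_mult_nth sum_distrib_left by (subst sum.swap) (simp add: mult_ac)
    also have "\<dots> = (\<Sum>m = 0..n. (-1) ^ (n - m) / of_nat (m + 1) *
        of_nat ((3 * m + 1) choose m) * of_nat ((m + 1) choose (n - m)))"
    proof (intro sum.cong refl)
      fix m assume "m \<in> {0..n}"
      \<comment> \<open>The factor \<open>1 - fps_X\<close> from \<open>F_gf 2\<close> accounts for
        \<open>m + 1\<close> in the second binomial coefficient.\<close>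
      moreover have "(1 - fps_X) * z ^ m = fps_X ^ m * (1 - fps_X) ^ (m + 1)"
        by (simp add: z_def power_mult_distrib mult_ac)
      ultimately show "raney 2 m * fps_nth ((1 - fps_X) * z ^ m) n = (-1) ^ (n - m) / of_nat (m + 1) *
          of_nat ((3 * m + 1) choose m) * of_nat ((m + 1) choose (n - m))"
        by (simp add: raney_2 fps_nth_X_power_one_minus_X_power del: binomial_Suc_Suc power_Suc)
    qed
    finally show ?thesis .
  qed
qed

end
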